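(* Let the leader's gain matrices $\bar K_k,\bar G_k\in\mathbb{R}^{m_2\times n}$, $0\le k\le N$, be given with $\bar G_0=0$ and the convention $\bar G_{N+1}=0$, and suppose the leader uses $u^l_k=\bar K_kx_k+\bar G_kx_{k-1}$. Suppose that the coupled Riccati equations (for $k=N,N-1,\dots,0$, with given terminal value $P_{N+1}$ and $S_{N+1}=0$) $$\begin{aligned}P_k={}&Q+\bar K_k'R_2\bar K_k+(A+B_2\bar K_k)'P_{k+1}(A+B_2\bar K_k)+(A+B_2\bar K_k)'S_{k+1}'+S_{k+1}(A+B_2\bar K_k)\\&-(M^1_k+M^B_k\bar K_k+B_1'S_{k+1}')'(\Gamma^f_k)^{-1}(M^1_k+M^B_k\bar K_k+B_1'S_{k+1}')+\bar G_{k+1}'\Delta_{k+1}\bar G_{k+1},\\ S_k={}&\bar G_k'\Delta_k\bar K_k+\bar G_k'\mathcal{M}^2_k\end{aligned}$$ (with $M^i_k,M^B_k,\Gamma^f_k,\Delta_k,\mathcal M^2_k$ as defined in the context) have a solution such that $\Gamma^f_k>0$ for $0\le k\le N$. Then the follower's optimal controller, i.e. the controller of the form $u^f_k=K_kx_k+G_kx_{k-1}$ minimizing $J^f$ given $u^l$, is $$u^f_k=-(\Gamma^f_k)^{-1}\big[M^1_k+M^B_k\bar K_k+B_1'S_{k+1}'\big]x_k-(\Gamma^f_k)^{-1}M^B_k\bar G_kx_{k-1},\qquad 0\le k\le N,$$ the follower's co-state (defined in the context) is given by $$\lambda^f_{k-1}=P_kx_k+S_k'x_{k-1},$$ and the follower's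 optimal cost value is $J^{f*}=x_0'P_0x_0$.
   Context: A prime denotes transpose; for a symmetric matrix $M$, $M>0$ means positive definite. System: $x_{k+1}=Ax_k+B_1u^f_k+B_2u^l_k$, $0\le k\le N$, with state $x_k\in\mathbb{R}^n$, given initial state $x_0$, follower's control $u^f_k\in\mathbb{R}^{m_1}$, leader's control $u^l_k\in\mathbb{R}^{m_2}$, and real constant matrices $A,B_1,B_2$ of compatible dimensions. Follower's cost: $J^f=\sum_{k=0}^N[x_k'Qx_k+(u^f_k)'R_1u^f_k+(u^l_k)'R_2u^l_k]+x_{N+1}'P_{N+1}x_{N+1}$, with $Q,P_{N+1}$ symmetric positive semi-definite and $R_1,R_2$ symmetric positive definite. Strategies (linear closed-loop with one-step memory): $u^f_k=K_kx_k+G_kx_{k-1}$ and $u^l_k=\bar K_kx_k+\bar G_kx_{k-1}$, with $K_k,G_k\in\mathbb{R}^{m_1\times n}$, $\bar K_k,\bar G_k\in\mathbb{R}^{m_2\times n}$, $G_0=0$, $\bar G_0=0$ (so no $x_{-1}$ is needed; terms containing $x_{-1}$ vanish). Notation: $M^i_k=B_i'P_{k+1}A$ ($i=1,2$), $M^B_k=B_1'P_{k+1}B_2$, $\Gamma^f_k=R_1+B_1'P_{k+1}B_1$, $\Delta_k=R_2+B_2'P_{k+1}B_2-(M^B_k)'(\Gamma^f_k)^{-1}M^B_k$, and $\mathcal M^2_k=M^2_k-(M^B_k)'(\Gamma^f_k)^{-1}M^1_k+[B_2-B_1(\Gamma^f_k)^{-1}M^B_k]'S_{k+1}'$. The term $\bar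 G_{N+1}'\Delta_{N+1}\bar G_{N+1}$ is zero. Follower's co-state: along the trajectory of the follower's controller $u^f_k=K_kx_k+G_kx_{k-1}$, the sequence $\lambda^f_k$ together with multipliers $\beta^f_k\in\mathbb{R}^{m_1}$ is determined by $\lambda^f_N=P_{N+1}x_{N+1}$, by $0=R_1u^f_k+B_1'\lambda^f_k-\beta^f_k$, and by $$\begin{aligned}\lambda^f_{k-1}={}&[Q+\bar K_k'R_2\bar K_k]x_k+\bar K_k'R_2\bar G_kx_{k-1}+\bar G_{k+1}'R_2\bar K_{k+1}x_{k+1}+\bar G_{k+1}'R_2\bar G_{k+1}x_k\\&+[A+B_2\bar K_k]'\lambda^f_k+\bar G_{k+1}'B_2'\lambda^f_{k+1}+K_k'\beta^f_k+G_{k+1}'\beta^f_{k+1},\end{aligned}$$ where for $k=N$ all terms containing $\bar G_{N+1}$ or $G_{N+1}$ are zero. *)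

theory Defs
  imports "HOL-Analysis.Analysis"
begin

definition pos_semidef :: "real^'n^'n \<Rightarrow> bool" where
  "pos_semidef M \<longleftrightarrow> transpose M = M \<and> (\<forall>v. 0 \<le> v \<bullet> (M *v v))"

definition pos_def :: "real^'n^'n \<Rightarrow> bool" where
  "pos_def M \<longleftrightarrow> transpose M = M \<and> (\<forall>v. v \<noteq> 0 \<longrightarrow> 0 < v \<bullet> (M *v v))"


section \<open>Closed loop with one-step-memory strategies\<close>

definition memory_control ::
  "(nat \<Rightarrow> real^'n^'m) \<Rightarrow> (nat \<Rightarrow> real^'n^'m) \<Rightarrow> nat \<Rightarrow> (real^'n) \<times> (real^'n) \<Rightarrow> real^'m" where
  "memory_control K G k z = K k *v fst z + G k *v snd z"

text \<open>At time \<open>k\<close> the closed loop is described by the pair \<open>(x\<^sub>k, x\<^sub>k\<^sub>-\<^sub>1)\<close>.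
  The value \<open>0\<close> of \<open>x\<^sub>-\<^sub>1\<close> is a placeholder: in all uses it is multiplied by a gain (or by
  \<open>S\<^sub>0\<close>) that vanishes at time \<open>0\<close>. The leader's gains are \<open>Kb\<close>, \<open>Gb\<close>, the follower's
  are \<open>K\<close>, \<open>G\<close>.\<close>

primrec closed_loop ::
  "real^'n^'n \<Rightarrow> real^'m1^'n \<Rightarrow> real^'m2^'n \<Rightarrow> (nat \<Rightarrow> real^'n^'m2) \<Rightarrow> (nat \<Rightarrow> real^'n^'m2)
    \<Rightarrow> real^'n \<Rightarrow> (nat \<Rightarrow> real^'n^'m1) \<Rightarrow> (nat \<Rightarrow> real^'n^'m1) \<Rightarrow> nat \<Rightarrow> (real^'n) \<times> (real^'n)" where
  "closed_loop A B1 B2 Kb Gb x0 K G 0 = (x0, 0)"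
| "closed_loop A B1 B2 Kb Gb x0 K G (Suc k) =
    (let z = closed_loop A B1 B2 Kb Gb x0 K G k
     in (A *v fst z + B1 *v memory_control K G k z + B2 *v memory_control Kb Gb k z, fst z))"

definition follower_cost ::
  "nat \<Rightarrow> real^'n^'n \<Rightarrow> real^'m1^'n \<Rightarrow> real^'m2^'n \<Rightarrow> real^'n^'n \<Rightarrow> real^'m1^'m1 \<Rightarrow> real^'m2^'m2
    \<Rightarrow> real^'n^'n \<Rightarrow> (nat \<Rightarrow> real^'n^'m2) \<Rightarrow> (nat \<Rightarrow> real^'n^'m2) \<Rightarrow> real^'n
    \<Rightarrow> (nat \<Rightarrow> real^'n^'m1) \<Rightarrow> (nat \<Rightarrow> real^'n^'m1) \<Rightarrow> real" where
  "follower_cost N A B1 B2 Q R1 R2 Pend Kb Gb x0 K G =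
    (let z = closed_loop A B1 B2 Kb Gb x0 K G;
         x = (\<lambda>k. fst (z k));
         uf = (\<lambda>k. memory_control K G k (z k));
         ul = (\<lambda>k. memory_control Kb Gb k (z k))
     in (\<Sum>k=0..N. x k \<bullet> (Q *v x k) + uf k \<bullet> (R1 *v uf k) + ul k \<bullet> (R2 *v ul k))
          + x (Suc N) \<bullet> (Pend *v x (Suc N)))"

definition follower_optimal ::
  "nat \<Rightarrow> real^'n^'n \<Rightarrow> real^'m1^'n \<Rightarrow> real^'m2^'n \<Rightarrow> real^'n^'n \<Rightarrow> real^'m1^'m1 \<Rightarrow> real^'m2^'m2
    \<Rightarrow> real^'n^'n \<Rightarrow> (nat \<Rightarrow> real^'n^'m2) \<Rightarrow> (nat \<Rightarrow> real^'n^'m2) \<Rightarrow> real^'n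
    \<Rightarrow> (nat \<Rightarrow> real^'n^'m1) \<Rightarrow> (nat \<Rightarrow> real^'n^'m1) \<Rightarrow> bool" where
  "follower_optimal N A B1 B2 Q R1 R2 Pend Kb Gb x0 K G \<longleftrightarrow>
    G 0 = 0 \<and>
    (\<forall>K' G'. G' 0 = 0 \<longrightarrow>
      follower_cost N A B1 B2 Q R1 R2 Pend Kb Gb x0 K G
        \<le> follower_cost N A B1 B2 Q R1 R2 Pend Kb Gb x0 K' G')"


section \<open>Co-state of the follower\<close>

text \<open>Index shift: \<open>lam k\<close> stands for \<open>\<lambda>\<^sup>f\<^sub>k\<^sub>-\<^sub>1\<close>, so \<open>lam\<close> is
  meaningful on \<open>0..N+1\<close>, while \<open>beta\<close> is meaningful on \<open>0..N\<close> and is not shifted.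
  The last summand collects the terms that are absent for \<open>k = N\<close>.\<close>

definition follower_costate ::
  "nat \<Rightarrow> real^'n^'n \<Rightarrow> real^'m1^'n \<Rightarrow> real^'m2^'n \<Rightarrow> real^'n^'n \<Rightarrow> real^'m1^'m1 \<Rightarrow> real^'m2^'m2
    \<Rightarrow> real^'n^'n \<Rightarrow> (nat \<Rightarrow> real^'n^'m2) \<Rightarrow> (nat \<Rightarrow> real^'n^'m2) \<Rightarrow> real^'n
    \<Rightarrow> (nat \<Rightarrow> real^'n^'m1) \<Rightarrow> (nat \<Rightarrow> real^'n^'m1)
    \<Rightarrow> (nat \<Rightarrow> real^'n) \<Rightarrow> (nat \<Rightarrow> real^'m1) \<Rightarrow> bool" where
  "follower_costate N A B1 B2 Q R1 R2 Pend Kb Gb x0 K G lam beta \<longleftrightarrow>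
    (let z = closed_loop A B1 B2 Kb Gb x0 K G;
         x = (\<lambda>k. fst (z k));
         xprev = (\<lambda>k. snd (z k));
         uf = (\<lambda>k. memory_control K G k (z k))
     in lam (Suc N) = Pend *v x (Suc N) \<and>
        (\<forall>k\<le>N. 0 = R1 *v uf k + transpose B1 *v lam (Suc k) - beta k) \<and>
        (\<forall>k\<le>N. lam k =
            (Q + transpose (Kb k) ** R2 ** Kb k) *v x k
          + (transpose (Kb k) ** R2 ** Gb k) *v xprev k
          + transpose (A + B2 ** Kb k) *v lam (Suc k)
          + transpose (K k) *v beta k
          + (if k = N then 0
             else (transpose (Gb (Suc k)) ** R2 ** Kb (Suc k)) *v x (Suc k)
                + (transpose (Gb (Suc k)) ** R2 ** Gb (Suc k)) *v x k
                + (transpose (Gb (Suc k)) ** transpose B2) *v lam (Suc (Suc k))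
                + transpose (G (Suc k)) *v beta (Suc k))))"


section \<open>Coupled Riccati equations\<close>

text \<open>In \<open>M_i A B P k\<close> the matrix \<open>B\<close> is \<open>B\<^sub>1\<close> or \<open>B\<^sub>2\<close>.\<close>

definition M_i :: "real^'n^'n \<Rightarrow> real^'m^'n \<Rightarrow> (nat \<Rightarrow> real^'n^'n) \<Rightarrow> nat \<Rightarrow> real^'n^'m" where
  "M_i A B P k = transpose B ** P (Suc k) ** A"

definition M_B ::
  "real^'m1^'n \<Rightarrow> real^'m2^'n \<Rightarrow> (nat \<Rightarrow> real^'n^'n) \<Rightarrow> nat \<Rightarrow> real^'m2^'m1" where
  "M_B B1 B2 P k = transpose B1 ** P (Suc k) ** B2"

definition Gamma_f ::
  "real^'m1^'n \<Rightarrow> real^'m1^'m1 \<Rightarrow> (nat \<Rightarrow> real^'n^'n) \<Rightarrow> nat \<Rightarrow> real^'m1^'m1" where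
  "Gamma_f B1 R1 P k = R1 + transpose B1 ** P (Suc k) ** B1"

definition Delta ::
  "real^'m1^'n \<Rightarrow> real^'m2^'n \<Rightarrow> real^'m1^'m1 \<Rightarrow> real^'m2^'m2 \<Rightarrow> (nat \<Rightarrow> real^'n^'n)
    \<Rightarrow> nat \<Rightarrow> real^'m2^'m2" where
  "Delta B1 B2 R1 R2 P k =
    R2 + transpose B2 ** P (Suc k) ** B2
      - transpose (M_B B1 B2 P k) ** matrix_inv (Gamma_f B1 R1 P k) ** M_B B1 B2 P k"

definition M_cal2 ::
  "real^'n^'n \<Rightarrow> real^'m1^'n \<Rightarrow> real^'m2^'n \<Rightarrow> real^'m1^'m1 \<Rightarrow> (nat \<Rightarrow> real^'n^'n)
    \<Rightarrow> (nat \<Rightarrow> real^'n^'n) \<Rightarrow> nat \<Rightarrow> real^'n^'m2" where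
  "M_cal2 A B1 B2 R1 P S k =
    M_i A B2 P k
      - transpose (M_B B1 B2 P k) ** matrix_inv (Gamma_f B1 R1 P k) ** M_i A B1 P k
      + transpose (B2 - B1 ** matrix_inv (Gamma_f B1 R1 P k) ** M_B B1 B2 P k)
          ** transpose (S (Suc k))"

definition M_follower ::
  "real^'n^'n \<Rightarrow> real^'m1^'n \<Rightarrow> real^'m2^'n \<Rightarrow> (nat \<Rightarrow> real^'n^'m2) \<Rightarrow> (nat \<Rightarrow> real^'n^'n)
    \<Rightarrow> (nat \<Rightarrow> real^'n^'n) \<Rightarrow> nat \<Rightarrow> real^'n^'m1" where
  "M_follower A B1 B2 Kb P S k =
    M_i A B1 P k + M_B B1 B2 P k ** Kb k + transpose B1 ** transpose (S (Suc k))"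

text \<open>For \<open>k = N\<close> the first equation mentions \<open>Delta\<close> at \<open>N+1\<close>, hence the
  arbitrary value \<open>P (N+2)\<close>. This is harmless under the convention \<open>Gb (N+1) = 0\<close>.\<close>

definition coupled_riccati ::
  "nat \<Rightarrow> real^'n^'n \<Rightarrow> real^'m1^'n \<Rightarrow> real^'m2^'n \<Rightarrow> real^'n^'n \<Rightarrow> real^'m1^'m1 \<Rightarrow> real^'m2^'m2
    \<Rightarrow> real^'n^'n \<Rightarrow> (nat \<Rightarrow> real^'n^'m2) \<Rightarrow> (nat \<Rightarrow> real^'n^'m2)
    \<Rightarrow> (nat \<Rightarrow> real^'n^'n) \<Rightarrow> (nat \<Rightarrow> real^'n^'n) \<Rightarrow> bool" where
  "coupled_riccati N A B1 B2 Q R1 R2 Pend Kb Gb P S \<longleftrightarrow>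
    P (Suc N) = Pend \<and> S (Suc N) = 0 \<and>
    (\<forall>k\<le>N.
      P k =
          Q + transpose (Kb k) ** R2 ** Kb k
        + transpose (A + B2 ** Kb k) ** P (Suc k) ** (A + B2 ** Kb k)
        + transpose (A + B2 ** Kb k) ** transpose (S (Suc k))
        + S (Suc k) ** (A + B2 ** Kb k)
        - transpose (M_follower A B1 B2 Kb P S k) ** matrix_inv (Gamma_f B1 R1 P k)
            ** M_follower A B1 B2 Kb P S k
        + transpose (Gb (Suc k)) ** Delta B1 B2 R1 R2 P (Suc k) ** Gb (Suc k) \<and>
      S k =
          transpose (Gb k) ** Delta B1 B2 R1 R2 P k ** Kb k
        + transpose (Gb k) ** M_cal2 A B1 B2 R1 P S k)"

definition follower_K ::
  "real^'n^'n \<Rightarrow> real^'m1^'n \<Rightarrow> real^'m2^'n \<Rightarrow> real^'m1^'m1 \<Rightarrow> (nat \<Rightarrow> real^'n^'m2)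
    \<Rightarrow> (nat \<Rightarrow> real^'n^'n) \<Rightarrow> (nat \<Rightarrow> real^'n^'n) \<Rightarrow> nat \<Rightarrow> real^'n^'m1" where
  "follower_K A B1 B2 R1 Kb P S k =
    - (matrix_inv (Gamma_f B1 R1 P k) ** M_follower A B1 B2 Kb P S k)"

definition follower_G ::
  "real^'m1^'n \<Rightarrow> real^'m2^'n \<Rightarrow> real^'m1^'m1 \<Rightarrow> (nat \<Rightarrow> real^'n^'m2)
    \<Rightarrow> (nat \<Rightarrow> real^'n^'n) \<Rightarrow> nat \<Rightarrow> real^'n^'m1" where
  "follower_G B1 B2 R1 Gb P k =
    - (matrix_inv (Gamma_f B1 R1 P k) ** M_B B1 B2 P k ** Gb k)"

end

theory Submission
  imports Defs
begin

text \<open>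
  The proof is dynamic programming for the pair \<open>(x\<^sub>k, x\<^sub>k\<^sub>-\<^sub>1)\<close>. Against the given leader, put
  \<open>V\<^sub>k(x, y) = x \<bullet> (P\<^sub>k x + S\<^sub>k' y) + y \<bullet> (S\<^sub>k x + W\<^sub>k y)\<close> with
  \<open>W\<^sub>k = Gb\<^sub>k' \<Delta>\<^sub>k Gb\<^sub>k\<close>. The last summand of the equation for \<open>P\<^sub>k\<close> is \<open>W\<^sub>k\<^sub>+\<^sub>1\<close>: the leader
  reacts at time \<open>k + 1\<close> to the present state \<open>x\<^sub>k\<close>, which is then the remembered one.

  Everything follows from three vector identities at one time step. Let \<open>u\<close> be the claimed control
  at \<open>(x, y)\<close>, \<open>w\<close> the leader's control, \<open>x\<^sup>+\<close> the successor state under \<open>u\<close> and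
  \<open>p = P\<^sub>k\<^sub>+\<^sub>1 x\<^sup>+ + S\<^sub>k\<^sub>+\<^sub>1' x\<close> the expected co-state. Then \<open>R1 u + B1' p = 0\<close>
  (\<open>stationarity\<close>), and the two Riccati equations say that the half gradients
  \<open>P\<^sub>k x + S\<^sub>k' y\<close> and \<open>S\<^sub>k x + W\<^sub>k y\<close> of \<open>V\<^sub>k\<close> are obtained from those of \<open>V\<^sub>k\<^sub>+\<^sub>1\<close> and of the
  running cost by the chain rule with \<open>u\<close> held fixed, as in the envelope theorem (\<open>riccati_current\<close>, \<open>riccati_memory\<close>).

  Pairing the last two identities with \<open>x\<close> and \<open>y\<close> gives the Bellman equation at \<open>u\<close>; by stationarity,
  a control \<open>u + d\<close> costs exactly \<open>d \<bullet> \<Gamma>\<^sub>k d\<close> more (\<open>bellman_completed_square\<close>). Summed along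
  a trajectory, the cost is \<open>x\<^sub>0 \<bullet> P\<^sub>0 x\<^sub>0\<close> plus the sum of these squares, whence optimality,
  the value, and the fact that every optimal controller applies the claimed control along its own
  trajectory. Along such a trajectory the multipliers \<open>\<beta>\<^sub>k\<close> vanish, so the co-state recursion does
  not see the particular gains that realise the control, and it is solved by
  \<open>P\<^sub>k x\<^sub>k + S\<^sub>k' x\<^sub>k\<^sub>-\<^sub>1\<close> because of the same two identities.
\<close>

section \<open>Transposes and inverses of real matrices\<close>

text \<open>Products with a transpose stay in the form \<open>transpose M *v v\<close>, so that the rules below can
  split them.\<close>

declare transpose_matrix_vector [simp del]

lemma transpose_add: "transpose (M + M' :: real^'a^'b) = transpose M + transpose M'"
  by (simp add: transpose_def vec_eq_iff)

lemma transpose_diff: "transpose (M - M' :: real^'a^'b) = transpose M - transpose M'"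
  by (simp add: transpose_def vec_eq_iff)

lemma matrix_vector_mult_uminus: "(- M) *v v = - (M *v v)" for M :: "real^'a^'b"
  using matrix_vector_mult_diff_rdistrib[of 0 M v] by simp

lemma matrix_vector_mult_uminus_right: "M *v (- v) = - (M *v v)" for M :: "real^'a^'b"
  using matrix_vector_mult_diff_distrib[of M 0 v] by simp

lemma inner_transpose_right: "x \<bullet> (transpose M *v y) = (M *v x) \<bullet> y"
  for M :: "real^'a^'b"
  by (metis dot_lmul_matrix vector_transpose_matrix)

text \<open>These rules turn an identity between matrix expressions applied to vectors into one between
  sums of vectors, each a chain of elementary matrices acting on one vector; comparing such
  sums needs only the laws of addition.\<close>

lemmas mat_vec_simps =
  transpose_add transpose_diff transpose_transpose matrix_transpose_mul
  matrix_vector_mul_assoc[symmetric] matrix_vector_mult_add_rdistrib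
  matrix_vector_mult_diff_rdistrib matrix_vector_right_distrib matrix_vector_mult_diff_distrib
  matrix_vector_mult_uminus matrix_vector_mult_uminus_right

lemma pos_def_symmetric: "pos_def M \<Longrightarrow> transpose M = M"
  by (simp add: pos_def_def)

lemma pos_def_invertible:
  assumes "pos_def M" shows "invertible M"
proof -
  have "v = 0" if "M *v v = 0" for v
    using assms that unfolding pos_def_def by (metis inner_zero_right less_irrefl)
  then show ?thesis
    by (simp add: invertible_left_inverse matrix_left_invertible_ker)
qed

lemma matrix_inv_right:
  fixes M :: "real^'a^'a"
  assumes "invertible M" shows "M ** matrix_inv M = mat 1"
  using assms unfolding invertible_def matrix_inv_def by (rule someI2_ex) blast

lemma matrix_inv_mult_vector:
  fixes M :: "real^'a^'a"
  assumes "invertible M" shows "M *v (matrix_inv M *v v) = v"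
  by (simp add: matrix_vector_mul_assoc matrix_inv_right[OF assms])

lemma transpose_matrix_inv:
  fixes M :: "real^'a^'a"
  assumes "invertible M" "transpose M = M"
  shows "transpose (matrix_inv M) = matrix_inv M"
proof -
  have "transpose (matrix_inv M) ** M = mat 1"
    by (metis assms matrix_inv_right matrix_transpose_mul transpose_mat)
  then show ?thesis
    by (metis assms(1) matrix_inv_right matrix_mul_assoc matrix_mul_lid matrix_mul_rid)
qed

section \<open>One step of the Riccati recursion\<close>

locale follower_riccati =
  fixes N :: nat
    and A Q Pend :: "real^'n^'n"
    and B1 :: "real^'m1^'n"
    and B2 :: "real^'m2^'n"
    and R1 :: "real^'m1^'m1"
    and R2 :: "real^'m2^'m2"
    and Kb Gb :: "nat \<Rightarrow> real^'n^'m2"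
    and P S :: "nat \<Rightarrow> real^'n^'n"
  assumes Q_sym: "transpose Q = Q" and Pend_sym: "transpose Pend = Pend"
    and R1_sym: "transpose R1 = R1" and R2_sym: "transpose R2 = R2"
    and Gb_0: "Gb 0 = 0" and Gb_end: "Gb (Suc N) = 0"
    and riccati: "coupled_riccati N A B1 B2 Q R1 R2 Pend Kb Gb P S"
    and Gamma_pos_def: "k \<le> N \<Longrightarrow> pos_def (Gamma_f B1 R1 P k)"
begin

abbreviation "\<Gamma> k \<equiv> Gamma_f B1 R1 P k"
abbreviation "\<Delta> k \<equiv> Delta B1 B2 R1 R2 P k"

text \<open>This is the quadratic weight of the remembered state in the cost to go; the Riccati equation
  for \<open>P k\<close> contains it with index \<open>Suc k\<close>.\<close>

definition W :: "nat \<Rightarrow> real^'n^'n" where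
  "W k = transpose (Gb k) ** \<Delta> k ** Gb k"

definition leader :: "nat \<Rightarrow> real^'n \<Rightarrow> real^'n \<Rightarrow> real^'m2" where
  "leader k x y = Kb k *v x + Gb k *v y"

definition best_response :: "nat \<Rightarrow> real^'n \<Rightarrow> real^'n \<Rightarrow> real^'m1" where
  "best_response k x y =
    follower_K A B1 B2 R1 Kb P S k *v x + follower_G B1 B2 R1 Gb P k *v y"

definition successor :: "nat \<Rightarrow> real^'n \<Rightarrow> real^'n \<Rightarrow> real^'m1 \<Rightarrow> real^'n" where
  "successor k x y u = A *v x + B1 *v u + B2 *v leader k x y"

definition costate_form :: "nat \<Rightarrow> real^'n \<Rightarrow> real^'n \<Rightarrow> real^'n" where
  "costate_form k x y = P k *v x + transpose (S k) *v y"

definition cost_to_go :: "nat \<Rightarrow> real^'n \<Rightarrow> real^'n \<Rightarrow> real" where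
  "cost_to_go k x y = x \<bullet> costate_form k x y + y \<bullet> (S k *v x + W k *v y)"

lemma P_end: "P (Suc N) = Pend" and S_end: "S (Suc N) = 0"
  using riccati by (simp_all add: coupled_riccati_def)

lemma P_eq: "k \<le> N \<Longrightarrow> P k =
    Q + transpose (Kb k) ** R2 ** Kb k
  + transpose (A + B2 ** Kb k) ** P (Suc k) ** (A + B2 ** Kb k)
  + transpose (A + B2 ** Kb k) ** transpose (S (Suc k))
  + S (Suc k) ** (A + B2 ** Kb k)
  - transpose (M_follower A B1 B2 Kb P S k) ** matrix_inv (\<Gamma> k)
      ** M_follower A B1 B2 Kb P S k
  + W (Suc k)"
  using riccati by (simp add: coupled_riccati_def W_def)

lemma S_eq: "k \<le> N \<Longrightarrow> S k =
    transpose (Gb k) ** \<Delta> k ** Kb k + transpose (Gb k) ** M_cal2 A B1 B2 R1 P S k"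
  using riccati by (simp add: coupled_riccati_def)

lemma W_end: "W (Suc N) = 0"
  by (simp add: W_def Gb_end)

lemma Gamma_invertible: "k \<le> N \<Longrightarrow> invertible (\<Gamma> k)"
  by (simp add: Gamma_pos_def pos_def_invertible)

lemma Gamma_inv_symmetric: "k \<le> N \<Longrightarrow> transpose (matrix_inv (\<Gamma> k)) = matrix_inv (\<Gamma> k)"
  by (simp add: Gamma_invertible Gamma_pos_def pos_def_symmetric transpose_matrix_inv)

lemma Delta_symmetric:
  assumes "k \<le> N" "transpose (P (Suc k)) = P (Suc k)"
  shows "transpose (\<Delta> k) = \<Delta> k"
  by (simp add: Delta_def transpose_add transpose_diff matrix_transpose_mul R2_sym assms
      Gamma_inv_symmetric matrix_mul_assoc)

text \<open>The equation for \<open>P k\<close> also involves \<open>P (k + 2)\<close>, through \<open>\<Delta> (Suc k)\<close>; hence the induction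
  on all later indices. At \<open>k = N\<close> that matrix is arbitrary, but it is multiplied by
  \<open>Gb (Suc N) = 0\<close>.\<close>

lemma P_symmetric: "k \<le> Suc N \<Longrightarrow> transpose (P k) = P k"
proof (induction "Suc N - k" arbitrary: k rule: less_induct)
  case less
  show ?case
  proof (cases "k = Suc N")
    case True
    then show ?thesis by (simp add: P_end Pend_sym)
  next
    case False
    with less.prems have k: "k \<le> N" by simp
    have P': "transpose (P (Suc k)) = P (Suc k)"
      using less.hyps[of "Suc k"] k by simp
    have W': "transpose (W (Suc k)) = W (Suc k)"
    proof (cases "k = N")
      case True
      then show ?thesis by (simp add: W_end transpose_def flip: zero_vec_def)
    next
      case False
      then have "transpose (\<Delta> (Suc k)) = \<Delta> (Suc k)"
        using k less.hyps[of "Suc (Suc k)"] by (intro Delta_symmetric) auto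
      then show ?thesis
        by (simp add: W_def matrix_transpose_mul matrix_mul_assoc)
    qed
    show ?thesis
      by (simp add: P_eq[OF k] transpose_add transpose_diff matrix_transpose_mul Q_sym R2_sym
          P' W' Gamma_inv_symmetric[OF k] matrix_mul_assoc)
  qed
qed

text \<open>Grouping the gains around the leader's control shows the feedback as the minimiser of a
  quadratic in \<open>u\<close> with leading matrix \<open>\<Gamma> k\<close>: the argument of \<open>transpose B1\<close> is the co-state at the
  successor reached with \<open>u = 0\<close>.\<close>

lemma best_response_eq:
  "best_response k x y = - (matrix_inv (\<Gamma> k) *v (transpose B1 *v
      (P (Suc k) *v (A *v x + B2 *v leader k x y) + transpose (S (Suc k)) *v x)))"
  by (simp add: best_response_def leader_def follower_K_def follower_G_def M_follower_def
      M_i_def M_B_def mat_vec_simps)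

text \<open>The multiplier \<open>\<beta>\<close> of the co-state system vanishes at the best response. Multiplying
  \<open>best_response_eq\<close> by \<open>\<Gamma> k\<close> and splitting \<open>\<Gamma> k = R1 + B1' P B1\<close> moves the summand with
  \<open>P B1\<close> into the successor state.\<close>

lemma stationarity:
  assumes "k \<le> N"
  shows "R1 *v best_response k x y
    + transpose B1 *v costate_form (Suc k) (successor k x y (best_response k x y)) x = 0"
proof -
  have "\<Gamma> k *v best_response k x y = - (transpose B1 *v
      (P (Suc k) *v (A *v x + B2 *v leader k x y) + transpose (S (Suc k)) *v x))"
    by (simp only: best_response_eq matrix_vector_mult_uminus_right
        matrix_inv_mult_vector[OF Gamma_invertible[OF assms]])
  then show ?thesis
    by (simp add: Gamma_f_def costate_form_def successor_def mat_vec_simps algebra_simps)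
qed

text \<open>With the follower's control held fixed, the remembered state acts only through the summand
  \<open>Gb k *v y\<close> of the leader's control. So its half gradient is the one with respect to the leader's control, pulled back by \<open>Gb k\<close>; the
  \<open>\<Gamma>\<close>-inverse terms in \<open>\<Delta>\<close> and \<open>M_cal2\<close> are what substituting the best response into the
  successor state produces. For index \<open>Suc k\<close> the right side is exactly the block of terms with
  \<open>Gb (Suc k)\<close> in the co-state recursion.\<close>

lemma riccati_memory:
  fixes x y :: "real^'n"
  assumes k: "k \<le> N"
  defines "u \<equiv> best_response k x y"
  shows "S k *v x + W k *v y = transpose (Gb k) *v
    (R2 *v leader k x y + transpose B2 *v costate_form (Suc k) (successor k x y u) x)"
proof -
  have P': "transpose (P (Suc k)) = P (Suc k)"
    using k by (simp add: P_symmetric)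
  show ?thesis
    unfolding u_def S_eq[OF k] W_def Delta_def M_cal2_def M_i_def M_B_def best_response_eq
      costate_form_def successor_def leader_def
    by (simp add: mat_vec_simps P' Gamma_inv_symmetric[OF k] algebra_simps)
qed

text \<open>Here the present state acts in two ways: through the dynamics, which gives the term with the
  next co-state, and as the memory of the next step, which gives the last bracket, the left side of
  \<open>riccati_memory\<close> for index \<open>Suc k\<close>.\<close>

lemma riccati_current:
  fixes x y :: "real^'n"
  assumes k: "k \<le> N"
  defines "x' \<equiv> successor k x y (best_response k x y)"
  shows "costate_form k x y = Q *v x + transpose (Kb k) *v (R2 *v leader k x y)
    + transpose (A + B2 ** Kb k) *v costate_form (Suc k) x' x
    + (S (Suc k) *v x' + W (Suc k) *v x)"
proof -
  have P': "transpose (P (Suc k)) = P (Suc k)"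
    using k by (simp add: P_symmetric)
  show ?thesis
    unfolding x'_def costate_form_def P_eq[OF k] S_eq[OF k] Delta_def M_cal2_def M_i_def M_B_def
      M_follower_def best_response_eq successor_def leader_def
    by (simp add: mat_vec_simps P' R2_sym Gamma_inv_symmetric[OF k] algebra_simps)
qed

text \<open>At \<open>v = u\<close> this is the Bellman equation, obtained by pairing the two gradient identities with
  \<open>x\<close> and \<open>y\<close>. For \<open>v = u + d\<close> the left side is a quadratic in \<open>d\<close> whose linear part vanishes by
  stationarity and whose quadratic part is \<open>R1 + B1' P B1 = \<Gamma> k\<close>.\<close>

lemma bellman_completed_square:
  fixes x y :: "real^'n" and v :: "real^'m1"
  assumes k: "k \<le> N"
  defines "u \<equiv> best_response k x y" and "w \<equiv> leader k x y"
  shows "x \<bullet> (Q *v x) + v \<bullet> (R1 *v v) + w \<bullet> (R2 *v w) + cost_to_go (Suc k) (successor k x y v) x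
    = cost_to_go k x y + (v - u) \<bullet> (\<Gamma> k *v (v - u))"
proof -
  define d where "d = v - u"
  define x' where "x' = successor k x y u"
  define p where "p = costate_form (Suc k) x' x"
  have v: "v = u + d" by (simp add: d_def)
  have x'_v: "successor k x y v = x' + B1 *v d"
    by (simp add: v x'_def successor_def mat_vec_simps)
  have stat: "R1 *v u + transpose B1 *v p = 0"
    using stationarity[OF k, of x y] by (simp add: u_def p_def x'_def)
  have stat_inner: "a \<bullet> (R1 *v u) + (B1 *v a) \<bullet> p = 0" for a
    using arg_cong[OF stat, of "\<lambda>b. a \<bullet> b"]
    by (simp add: inner_add_right inner_transpose_right)
  have P': "(P (Suc k) *v a) \<bullet> b = a \<bullet> (P (Suc k) *v b)" for a b
    using inner_transpose_right[of a "P (Suc k)" b] P_symmetric[of "Suc k"] k by simp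
  have R1': "(R1 *v a) \<bullet> b = a \<bullet> (R1 *v b)" for a b
    using inner_transpose_right[of a R1 b] R1_sym by simp
  have "cost_to_go k x y = x \<bullet> (Q *v x) + w \<bullet> (R2 *v w) + (A *v x + B2 *v w) \<bullet> p
      + x \<bullet> (S (Suc k) *v x' + W (Suc k) *v x)"
    unfolding cost_to_go_def riccati_current[OF k] riccati_memory[OF k]
    by (simp add: inner_add_right inner_add_left inner_transpose_right mat_vec_simps
        w_def p_def x'_def u_def leader_def)
  \<comment> \<open>The pairing yields the drift without the follower's control; stationarity exchanges the
    missing \<open>B1 *v u\<close> for the control cost \<open>u \<bullet> R1 u\<close>.\<close>
  also have "A *v x + B2 *v w = x' - B1 *v u"
    by (simp add: x'_def successor_def w_def)
  also have "(x' - B1 *v u) \<bullet> p = x' \<bullet> p + u \<bullet> (R1 *v u)"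
    using stat_inner[of u] by (simp add: inner_diff_left)
  finally have opt: "cost_to_go k x y =
      x \<bullet> (Q *v x) + u \<bullet> (R1 *v u) + w \<bullet> (R2 *v w) + cost_to_go (Suc k) x' x"
    by (simp add: cost_to_go_def p_def)
  have "cost_to_go (Suc k) (x' + B1 *v d) x = cost_to_go (Suc k) x' x
      + 2 * ((B1 *v d) \<bullet> p) + (B1 *v d) \<bullet> (P (Suc k) *v (B1 *v d))"
    using P'[of x' "B1 *v d"] inner_transpose_right[of "B1 *v d" "S (Suc k)" x]
    by (simp add: cost_to_go_def costate_form_def p_def mat_vec_simps inner_add_left
        inner_add_right inner_transpose_right inner_commute algebra_simps)
  moreover have "v \<bullet> (R1 *v v) = u \<bullet> (R1 *v u) + 2 * (d \<bullet> (R1 *v u)) + d \<bullet> (R1 *v d)"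
    using R1'[of u d]
    by (simp add: v mat_vec_simps inner_add_left inner_add_right inner_commute algebra_simps)
  moreover have "d \<bullet> (\<Gamma> k *v d) = d \<bullet> (R1 *v d) + (B1 *v d) \<bullet> (P (Suc k) *v (B1 *v d))"
    by (simp add: Gamma_f_def mat_vec_simps inner_add_right inner_transpose_right)
  ultimately show ?thesis
    using opt stat_inner[of d] unfolding x'_v d_def[symmetric] by simp
qed

section \<open>Cost and optimal controllers\<close>

context
  fixes x0 :: "real^'n" and K G :: "nat \<Rightarrow> real^'n^'m1"
begin

abbreviation "state k \<equiv> fst (closed_loop A B1 B2 Kb Gb x0 K G k)"
abbreviation "memory k \<equiv> snd (closed_loop A B1 B2 Kb Gb x0 K G k)"
abbreviation "control k \<equiv> memory_control K G k (closed_loop A B1 B2 Kb Gb x0 K G k)"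
abbreviation "deviation k \<equiv> control k - best_response k (state k) (memory k)"

lemma state_Suc: "state (Suc k) = successor k (state k) (memory k) (control k)"
  by (simp add: Let_def successor_def leader_def memory_control_def)

lemma memory_Suc: "memory (Suc k) = state k"
  by (simp add: Let_def)

text \<open>The squares are evaluated along the trajectory of the gains \<open>K\<close>, \<open>G\<close> themselves, so the
  formula compares all admissible controllers with the single constant \<open>x0 \<bullet> P 0 x0\<close>. The
  cost to go telescopes; at time \<open>0\<close> the memory is \<open>0\<close>, and at time \<open>N + 1\<close> only the terminal
  weight survives.\<close>

lemma follower_cost_eq:
  "follower_cost N A B1 B2 Q R1 R2 Pend Kb Gb x0 K G
    = x0 \<bullet> (P 0 *v x0) + (\<Sum>k=0..N. deviation k \<bullet> (\<Gamma> k *v deviation k))"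
proof -
  let ?V = "\<lambda>k. cost_to_go k (state k) (memory k)"
  let ?l = "\<lambda>k. state k \<bullet> (Q *v state k) + control k \<bullet> (R1 *v control k)
      + leader k (state k) (memory k) \<bullet> (R2 *v leader k (state k) (memory k))"
  have step: "?l k = deviation k \<bullet> (\<Gamma> k *v deviation k) + (?V k - ?V (Suc k))" if "k \<le> N" for k
    using bellman_completed_square[OF that, of "state k" "control k" "memory k"]
    by (simp only: state_Suc memory_Suc)
  have "(\<Sum>k=0..N. ?l k) =
      (\<Sum>k=0..N. deviation k \<bullet> (\<Gamma> k *v deviation k)) + (\<Sum>k=0..N. ?V k - ?V (Suc k))"
    unfolding sum.distrib[symmetric] by (intro sum.cong refl step) simp
  also have "(\<Sum>k=0..N. ?V k - ?V (Suc k)) = ?V 0 - ?V (Suc N)"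
    using sum_telescope[of ?V N] by (simp only: atMost_atLeast0)
  also have "?V (Suc N) = state (Suc N) \<bullet> (Pend *v state (Suc N))"
    by (simp add: cost_to_go_def costate_form_def P_end S_end W_end transpose_def
        del: closed_loop.simps flip: zero_vec_def)
  also have "?V 0 = x0 \<bullet> (P 0 *v x0)"
    by (simp add: cost_to_go_def costate_form_def)
  finally show ?thesis
    by (simp add: follower_cost_def Let_def memory_control_def leader_def del: closed_loop.simps)
qed

lemma deviation_cost_nonneg: "k \<le> N \<Longrightarrow> 0 \<le> deviation k \<bullet> (\<Gamma> k *v deviation k)"
  using Gamma_pos_def[of k] by (cases "deviation k = 0") (auto simp: pos_def_def less_imp_le)

lemma follower_cost_lower_bound:
  "x0 \<bullet> (P 0 *v x0) \<le> follower_cost N A B1 B2 Q R1 R2 Pend Kb Gb x0 K G"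
proof -
  have "0 \<le> (\<Sum>k=0..N. deviation k \<bullet> (\<Gamma> k *v deviation k))"
    by (rule sum_nonneg, rule deviation_cost_nonneg) simp
  then show ?thesis by (simp add: follower_cost_eq)
qed

text \<open>Only controls are determined, not gains: several pairs \<open>K\<close>, \<open>G\<close> can produce the same
  control along one trajectory.\<close>

lemma best_response_if_cost_minimal:
  assumes "follower_cost N A B1 B2 Q R1 R2 Pend Kb Gb x0 K G = x0 \<bullet> (P 0 *v x0)" "k \<le> N"
  shows "control k = best_response k (state k) (memory k)"
proof -
  have "(\<Sum>k=0..N. deviation k \<bullet> (\<Gamma> k *v deviation k)) = 0"
    using assms(1) by (simp add: follower_cost_eq)
  then have "deviation k \<bullet> (\<Gamma> k *v deviation k) = 0"
    using assms(2) deviation_cost_nonneg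
    by (subst (asm) sum_nonneg_eq_0_iff) auto
  then have "deviation k = 0"
    using Gamma_pos_def[OF assms(2)] unfolding pos_def_def by (metis less_irrefl)
  then show ?thesis by simp
qed

section \<open>The co-state along a best-response trajectory\<close>

context
  assumes best: "k \<le> N \<Longrightarrow> control k = best_response k (state k) (memory k)"
begin

abbreviation "costate k \<equiv> costate_form k (state k) (memory k)"

lemma multiplier_vanishes: "k \<le> N \<Longrightarrow> R1 *v control k + transpose B1 *v costate (Suc k) = 0"
  using stationarity[of k "state k" "memory k"] best[of k] by (simp only: state_Suc memory_Suc)

text \<open>This is \<open>riccati_current\<close> along the trajectory, with its last bracket expanded by
  \<open>riccati_memory\<close> one step later. At \<open>k = N\<close> the bracket is zero because \<open>S\<close> and \<open>W\<close> vanish at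
  \<open>N + 1\<close>. The summands with \<open>\<beta>\<close> are absent because the multipliers vanish.\<close>

lemma costate_recursion:
  assumes k: "k \<le> N"
  shows "costate k =
      (Q + transpose (Kb k) ** R2 ** Kb k) *v state k
    + (transpose (Kb k) ** R2 ** Gb k) *v memory k
    + transpose (A + B2 ** Kb k) *v costate (Suc k)
    + (if k = N then 0
       else (transpose (Gb (Suc k)) ** R2 ** Kb (Suc k)) *v state (Suc k)
          + (transpose (Gb (Suc k)) ** R2 ** Gb (Suc k)) *v state k
          + (transpose (Gb (Suc k)) ** transpose B2) *v costate (Suc (Suc k)))"
    (is "_ = _ + _ + _ + ?rest")
proof -
  have "S (Suc k) *v state (Suc k) + W (Suc k) *v state k = ?rest"
  proof (cases "k = N")
    case True
    then show ?thesis by (simp add: S_end W_end del: closed_loop.simps)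
  next
    case False
    with k have k': "Suc k \<le> N" by simp
    have "S (Suc k) *v state (Suc k) + W (Suc k) *v memory (Suc k) = transpose (Gb (Suc k)) *v
        (R2 *v leader (Suc k) (state (Suc k)) (memory (Suc k))
          + transpose B2 *v costate (Suc (Suc k)))"
      by (simp only: riccati_memory[OF k'] state_Suc[of "Suc k"] memory_Suc[of "Suc k"] best[OF k'])
    then show ?thesis
      using False
      by (simp add: leader_def mat_vec_simps memory_Suc add.assoc del: closed_loop.simps)
  qed
  moreover have "costate k = Q *v state k
      + transpose (Kb k) *v (R2 *v leader k (state k) (memory k))
      + transpose (A + B2 ** Kb k) *v costate (Suc k)
      + (S (Suc k) *v state (Suc k) + W (Suc k) *v state k)"
    by (simp only: riccati_current[OF k] state_Suc[of k] memory_Suc[of k] best[OF k])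
  ultimately show ?thesis
    by (simp add: leader_def mat_vec_simps algebra_simps del: closed_loop.simps)
qed

lemma costate_exists: "follower_costate N A B1 B2 Q R1 R2 Pend Kb Gb x0 K G costate (\<lambda>_. 0)"
proof -
  have "costate (Suc N) = Pend *v state (Suc N)"
    by (simp add: costate_form_def P_end S_end transpose_def del: closed_loop.simps
        flip: zero_vec_def)
  then show ?thesis
    using costate_recursion multiplier_vanishes
    by (simp add: follower_costate_def Let_def memory_Suc del: closed_loop.simps)
qed

text \<open>The recursion runs backwards and determines \<open>lam k\<close> from \<open>lam\<close> at the next two indices and
  from \<open>beta k\<close>, \<open>beta (Suc k)\<close>. The vanishing of the multipliers is carried along in the
  induction: it removes the gains \<open>K\<close>, \<open>G\<close>, about which only the resulting control is known.\<close>

lemma costate_unique: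
  assumes lam: "follower_costate N A B1 B2 Q R1 R2 Pend Kb Gb x0 K G lam beta"
    and "k \<le> Suc N"
  shows "lam k = costate k \<and> (k \<le> N \<longrightarrow> beta k = 0)"
  using assms(2)
proof (induction "Suc N - k" arbitrary: k rule: less_induct)
  case less
  show ?case
  proof (cases "k = Suc N")
    case True
    then show ?thesis
      using lam by (simp add: follower_costate_def Let_def costate_form_def P_end S_end
          transpose_def del: closed_loop.simps flip: zero_vec_def)
  next
    case False
    with less.prems have k: "k \<le> N" by simp
    have lam1: "lam (Suc k) = costate (Suc k)"
      using less.hyps[of "Suc k"] k by simp
    have later: "k \<noteq> N \<Longrightarrow> lam (Suc (Suc k)) = costate (Suc (Suc k)) \<and> beta (Suc k) = 0"
      using less.hyps[of "Suc k"] less.hyps[of "Suc (Suc k)"] k by simp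
    have "0 = R1 *v control k + transpose B1 *v lam (Suc k) - beta k"
      using lam k by (simp add: follower_costate_def Let_def del: closed_loop.simps)
    then have beta: "beta k = 0"
      using multiplier_vanishes[OF k] lam1 by (simp del: closed_loop.simps)
    have "lam k = costate k"
      unfolding costate_recursion[OF k]
      using lam k beta lam1 later
      by (simp add: follower_costate_def Let_def del: closed_loop.simps)
    then show ?thesis using beta by simp
  qed
qed

end

end

end

theorem theorem1:
  fixes N :: nat
    and A Q Pend :: "real^'n^'n"
    and B1 :: "real^'m1^'n"
    and B2 :: "real^'m2^'n"
    and R1 :: "real^'m1^'m1"
    and R2 :: "real^'m2^'m2"
    and x0 :: "real^'n"
    and Kb Gb :: "nat \<Rightarrow> real^'n^'m2"
    and P S :: "nat \<Rightarrow> real^'n^'n"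
  assumes "pos_semidef Q" and "pos_semidef Pend" and "pos_def R1" and "pos_def R2"
    and "Gb 0 = 0" and "Gb (Suc N) = 0"
    and "coupled_riccati N A B1 B2 Q R1 R2 Pend Kb Gb P S"
    and "\<And>k. k \<le> N \<Longrightarrow> pos_def (Gamma_f B1 R1 P k)"
  shows
    "follower_optimal N A B1 B2 Q R1 R2 Pend Kb Gb x0
        (follower_K A B1 B2 R1 Kb P S) (follower_G B1 B2 R1 Gb P)
     \<and> (\<forall>K G. follower_optimal N A B1 B2 Q R1 R2 Pend Kb Gb x0 K G \<longrightarrow>
          (\<forall>k\<le>N. memory_control K G k (closed_loop A B1 B2 Kb Gb x0 K G k)
              = memory_control (follower_K A B1 B2 R1 Kb P S) (follower_G B1 B2 R1 Gb P) k
                  (closed_loop A B1 B2 Kb Gb x0 K G k))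
        \<and> (\<exists>lam beta. follower_costate N A B1 B2 Q R1 R2 Pend Kb Gb x0 K G lam beta)
        \<and> (\<forall>lam beta. follower_costate N A B1 B2 Q R1 R2 Pend Kb Gb x0 K G lam beta \<longrightarrow>
            (\<forall>k\<le>Suc N. lam k
                = P k *v fst (closed_loop A B1 B2 Kb Gb x0 K G k)
                + transpose (S k) *v snd (closed_loop A B1 B2 Kb Gb x0 K G k)))
        \<and> follower_cost N A B1 B2 Q R1 R2 Pend Kb Gb x0 K G = x0 \<bullet> (P 0 *v x0))"
proof -
  interpret follower_riccati N A Q Pend B1 B2 R1 R2 Kb Gb P S
    using assms by unfold_locales (simp_all add: pos_def_def pos_semidef_def)
  let ?J = "follower_cost N A B1 B2 Q R1 R2 Pend Kb Gb x0"
  let ?K = "follower_K A B1 B2 R1 Kb P S" and ?G = "follower_G B1 B2 R1 Gb P"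
  have control_eq: "memory_control ?K ?G k z = best_response k (fst z) (snd z)" for k z
    by (simp add: memory_control_def best_response_def)
  have optimal_value: "?J ?K ?G = x0 \<bullet> (P 0 *v x0)"
    by (simp add: follower_cost_eq control_eq)
  have G0: "?G 0 = 0"
    by (simp add: follower_G_def Gb_0)
  have opt: "follower_optimal N A B1 B2 Q R1 R2 Pend Kb Gb x0 ?K ?G"
    by (simp add: follower_optimal_def G0 optimal_value follower_cost_lower_bound)
  have minimal: "?J K G = x0 \<bullet> (P 0 *v x0)"
    if "follower_optimal N A B1 B2 Q R1 R2 Pend Kb Gb x0 K G" for K G
    using that G0 optimal_value follower_cost_lower_bound[of x0 K G]
    by (metis follower_optimal_def order_antisym)
  show ?thesis
  proof (intro conjI opt allI impI)
    fix K G
    assume *: "follower_optimal N A B1 B2 Q R1 R2 Pend Kb Gb x0 K G"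
    note best = best_response_if_cost_minimal[OF minimal[OF *]]
    show "?J K G = x0 \<bullet> (P 0 *v x0)" by (rule minimal[OF *])
    show "\<exists>lam beta. follower_costate N A B1 B2 Q R1 R2 Pend Kb Gb x0 K G lam beta"
      using costate_exists[OF best] by blast
    show "memory_control K G k (closed_loop A B1 B2 Kb Gb x0 K G k)
        = memory_control ?K ?G k (closed_loop A B1 B2 Kb Gb x0 K G k)" if "k \<le> N" for k
      using best[OF that] by (simp add: control_eq)
    show "lam k = P k *v fst (closed_loop A B1 B2 Kb Gb x0 K G k)
        + transpose (S k) *v snd (closed_loop A B1 B2 Kb Gb x0 K G k)"
      if "follower_costate N A B1 B2 Q R1 R2 Pend Kb Gb x0 K G lam beta" "k \<le> Suc N" for lam beta k
      using costate_unique[OF best that] by (simp add: costate_form_def)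
  qed
qed

end
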